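(* Let $c,d>0$ and let $C\in\mathbb{R}$ satisfy $|C|<cd$. Let $E_0$ be the ellipse with equation $$d^{2}x^{2}+c^{2}y^{2}+2Cxy-2cd^{2}x-2c^{2}dy+c^{2}d^{2}=0,$$ which lies in the first quadrant and is tangent to the positive $x$ and $y$ axes at $(c,0)$ and $(0,d)$ respectively. For $s>0$, an admissible ladder of length $s$ is a segment with endpoints $(u,0)$ and $(0,v)$, where $u,v>0$ and $u^2+v^2=s^2$, such that $E_0$ is inscribed in the triangle with vertices $(0,0),(u,0),(0,v)$. Put $J=\frac12\left(1+\frac{C}{cd}\right)\in(0,1)$ and, for $t\in(0,J)$, $$f(t)=\frac{c^{2}}{t^{2}}+\frac{d^{2}(1-t)^{2}}{(J-t)^{2}}.$$ Then: (a) $f'$ has exactly one root $t_0$ in $(0,J)$. (b) There is a unique value $s_0>0$ such that, for $s>0$, an admissible ladder of length $s$ exists if and only if $s\ge s_0$; moreover $s_0^2=f(t_0)$. (c) For $s=s_0$ there is exactly one admissible ladder of length $s$, and for every $s>s_0$ there are exactly two different admissible ladders of length $s$.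
   Context: The ellipses lying in the closed first quadrant and tangent to the positive $x$-axis at $(c,0)$ and to the positive $y$-axis at $(0,d)$ are exactly those with an equation of the displayed form with $|C|<cd$. An ellipse is inscribed in a triangle if it is contained in the closed triangular region and is tangent to each of the three sides of the triangle. Two admissible ladders are the same if and only if they have the same pair $(u,v)$. *)

theory Defs
  imports "HOL-Analysis.Analysis"
begin

text \<open>The plane is \<open>real \<times> real\<close>; an ellipse is the curve, not the region it bounds.\<close>

definition ellipse0 :: "real \<Rightarrow> real \<Rightarrow> real \<Rightarrow> (real \<times> real) set" where
  "ellipse0 c d C =
     {(x, y). d^2 * x^2 + c^2 * y^2 + 2 * C * x * y - 2 * c * d^2 * x - 2 * c^2 * d * y
              + c^2 * d^2 = 0}"

text \<open>
  A line is tangent to an ellipse if the two have exactly one common point. For tangency to a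
  side of a triangle, that point has to lie on the side itself and not only on the line
  through it. The definition is meant for ellipses \<open>E\<close> and for \<open>a \<noteq> b\<close>.
\<close>

definition tangent_to_side ::
    "(real \<times> real) set \<Rightarrow> real \<times> real \<Rightarrow> real \<times> real \<Rightarrow> bool" where
  "tangent_to_side E a b \<longleftrightarrow> (\<exists>p \<in> closed_segment a b. E \<inter> affine hull {a, b} = {p})"

definition inscribed_in_triangle ::
    "(real \<times> real) set \<Rightarrow> real \<times> real \<Rightarrow> real \<times> real \<Rightarrow> real \<times> real \<Rightarrow> bool" where
  "inscribed_in_triangle E P Q R \<longleftrightarrow>
     E \<subseteq> convex hull {P, Q, R} \<and>
     tangent_to_side E P Q \<and> tangent_to_side E Q R \<and> tangent_to_side E R P"

text \<open>A ladder is identified with the pair \<open>(u, v)\<close> of its intercepts.\<close>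

definition admissible_ladders :: "real \<Rightarrow> real \<Rightarrow> real \<Rightarrow> real \<Rightarrow> (real \<times> real) set" where
  "admissible_ladders c d C s =
     {(u, v). u > 0 \<and> v > 0 \<and> u^2 + v^2 = s^2 \<and>
              inscribed_in_triangle (ellipse0 c d C) (0, 0) (u, 0) (0, v)}"

definition ladder_J :: "real \<Rightarrow> real \<Rightarrow> real \<Rightarrow> real" where
  "ladder_J c d C = 1/2 * (1 + C / (c * d))"

definition ladder_f :: "real \<Rightarrow> real \<Rightarrow> real \<Rightarrow> real \<Rightarrow> real" where
  "ladder_f c d C t = c^2 / t^2 + d^2 * (1 - t)^2 / (ladder_J c d C - t)^2"

definition is_critical_point :: "real \<Rightarrow> real \<Rightarrow> real \<Rightarrow> real \<Rightarrow> bool" where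
  "is_critical_point c d C t \<longleftrightarrow>
     t \<in> {0<..<ladder_J c d C} \<and> deriv (ladder_f c d C) t = 0"

definition is_threshold :: "real \<Rightarrow> real \<Rightarrow> real \<Rightarrow> real \<Rightarrow> bool" where
  "is_threshold c d C s0 \<longleftrightarrow>
     s0 > 0 \<and> (\<forall>s>0. admissible_ladders c d C s \<noteq> {} \<longleftrightarrow> s \<ge> s0)"

end

theory Submission imports Defs begin

text \<open>
  In the coordinates \<open>X = x/c\<close>, \<open>Y = y/d\<close> the ellipse is \<open>(X + Y - 1)\<^sup>2 = 4 (1 - J) X Y\<close>, and
  the ladder lies on the line \<open>p X + q Y = 1\<close> with \<open>p = c/u\<close>, \<open>q = d/v\<close>. Subtracting the equation
  of the line makes the restricted equation homogeneous,
  \<open>((1 - p) X + (1 - q) Y)\<^sup>2 = 4 (1 - J) X Y\<close>, which has a double root iff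
  \<open>(1 - p) (1 - q) = 1 - J\<close>. Solving this for \<open>q\<close> with \<open>t = p\<close> as parameter gives
  \<open>u\<^sup>2 + v\<^sup>2 = f t\<close>. Since \<open>f'\<close> is strictly increasing and \<open>f\<close> is unbounded at both ends of \<open>(0, J)\<close>,
  the level sets of \<open>f\<close> have 0, 1 or 2 points.
\<close>

section \<open>Tangency\<close>

lemma ladder_J_bounds:
  assumes "c > 0" "d > 0" "\<bar>C\<bar> < c * d"
  shows "0 < ladder_J c d C" "ladder_J c d C < 1"
proof -
  have "0 < c * d" using assms by simp
  then have "\<bar>C / (c * d)\<bar> < 1" using assms by (simp add: abs_mult)
  then have "C / (c * d) < 1" "- (C / (c * d)) < 1" by (simp_all only: abs_less_iff)
  then show "0 < ladder_J c d C" "ladder_J c d C < 1"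
    unfolding ladder_J_def by simp_all
qed

lemma mem_ellipse0_iff:
  assumes "c > 0" "d > 0"
  shows "(x, y) \<in> ellipse0 c d C \<longleftrightarrow>
         (x/c + y/d - 1)^2 = 4 * (1 - ladder_J c d C) * (x/c) * (y/d)"
proof -
  have "d^2 * x^2 + c^2 * y^2 + 2 * C * x * y - 2 * c * d^2 * x - 2 * c^2 * d * y + c^2 * d^2
        = c^2 * d^2 * ((x/c + y/d - 1)^2 - 4 * (1 - ladder_J c d C) * (x/c) * (y/d))"
    using assms by (simp add: ladder_J_def power2_eq_square field_simps)
  then show ?thesis using assms by (simp add: ellipse0_def)
qed

lemma ellipse0_tangency_points:
  "(c, 0) \<in> ellipse0 c d C" "(0, d) \<in> ellipse0 c d C"
  by (auto simp: ellipse0_def power2_eq_square algebra_simps)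

text \<open>Completing the square in \<open>Y\<close> leaves the term
  \<open>4 * m * X * ((1 - m) * X - 1)\<close>. For \<open>X < 0\<close> both \<open>X\<close> and
  the bracket are negative, so this term is positive. The equation is symmetric in \<open>X\<close>
  and \<open>Y\<close>, so the same bound serves for \<open>Y\<close>.\<close>

lemma conic_nonneg:
  fixes X Y m :: real
  assumes "0 < m" "m < 1" and eq: "(X + Y - 1)^2 = 4 * m * X * Y"
  shows "X \<ge> 0"
proof (rule ccontr)
  assume "\<not> X \<ge> 0"
  have "(Y + (1 - 2*m) * X - 1)^2 + 4 * m * X * ((1 - m) * X - 1) = 0"
    using eq by (simp add: power2_eq_square algebra_simps)
  moreover have "(1 - m) * X - 1 < 0"
    using \<open>\<not> X \<ge> 0\<close> assms by (smt (verit) mult_pos_neg)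
  then have "4 * m * X * ((1 - m) * X - 1) > 0"
    using \<open>\<not> X \<ge> 0\<close> assms by (intro mult_neg_neg) (auto simp: mult_pos_neg)
  ultimately show False by (smt (verit) zero_le_power2)
qed

text \<open>With \<open>L\<close> the excess over the bound,
  \<open>X + Y - 1 = a * X + b * Y + L\<close>. Because the coefficient is
  \<open>4 * (a * b)\<close>, the terms free of \<open>L\<close> combine to the square of
  \<open>a * X - b * Y\<close>, and \<open>L > 0\<close> would make a sum that equals zero
  positive.\<close>

lemma conic_below_tangent:
  fixes X Y a b :: real
  assumes "X \<ge> 0" "Y \<ge> 0" "a > 0" "b > 0" and eq: "(X + Y - 1)^2 = 4 * (a * b) * X * Y"
  shows "(1 - a) * X + (1 - b) * Y \<le> 1"
proof (rule ccontr)
  define L where "L = (1 - a) * X + (1 - b) * Y - 1"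
  assume "\<not> (1 - a) * X + (1 - b) * Y \<le> 1"
  then have "L > 0" by (simp add: L_def)
  have "(a * X - b * Y)^2 + 2 * L * (a * X + b * Y) + L^2 = 0"
    using eq by (simp add: L_def power2_eq_square algebra_simps)
  moreover have "2 * L * (a * X + b * Y) \<ge> 0" "L^2 > 0"
    using \<open>L > 0\<close> assms by auto
  ultimately show False by (smt (verit) zero_le_power2)
qed

text \<open>By Vieta \<open>w = - B / A - r\<close> is also a root, so uniqueness forces
  \<open>w = r\<close>, a double root.\<close>

lemma quadratic_unique_root_discrim:
  fixes A B D r :: real
  assumes "A \<noteq> 0" "A * r^2 + B * r + D = 0"
    and uniq: "\<And>s. A * s^2 + B * s + D = 0 \<Longrightarrow> s = r"
  shows "B^2 = 4 * A * D"
proof -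
  define w where "w = - B / A - r"
  have Aw: "A * w = - B - A * r" using assms(1) by (simp add: w_def algebra_simps)
  have "A * w^2 + B * w = (A * w + B) * w" by (simp add: power2_eq_square algebra_simps)
  also have "\<dots> = - r * (A * w)" by (simp add: Aw)
  also have "\<dots> = A * r^2 + B * r" by (simp add: Aw power2_eq_square algebra_simps)
  finally have "w = r" using assms(2) by (intro uniq) simp
  then have B: "B = - 2 * A * r" using Aw by simp
  then have "D = A * r^2" using assms(2) by (simp add: power2_eq_square algebra_simps)
  then show ?thesis using B by (simp add: power2_eq_square)
qed

lemma affine_hull_hypotenuse:
  "affine hull {(u, 0), (0, v)} = range (\<lambda>s::real. ((1 - s) * u, s * v :: real))"
  by (auto simp: affine_hull_2_alt algebra_simps)

lemma closed_segment_hypotenuse: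
  "closed_segment (u, 0) (0, v) = (\<lambda>s::real. ((1 - s) * u, s * v :: real)) ` {0..1}"
  by (auto simp: closed_segment_def)

lemma mem_triangle_iff:
  fixes u v :: real
  assumes "u > 0" "v > 0"
  shows "(x, y) \<in> convex hull {(0, 0), (u, 0), (0, v)} \<longleftrightarrow> x \<ge> 0 \<and> y \<ge> 0 \<and> x/u + y/v \<le> 1"
proof
  assume "(x, y) \<in> convex hull {(0, 0), (u, 0), (0, v)}"
  then obtain a b e where "a \<ge> 0" "b \<ge> 0" "e \<ge> 0" "a + b + e = 1" "x = b * u" "y = e * v"
    by (auto simp: convex_hull_3)
  then show "x \<ge> 0 \<and> y \<ge> 0 \<and> x/u + y/v \<le> 1" using assms by simp
next
  assume "x \<ge> 0 \<and> y \<ge> 0 \<and> x/u + y/v \<le> 1"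
  then have "\<exists>a b e. 0 \<le> a \<and> 0 \<le> b \<and> 0 \<le> e \<and> a + b + e = 1 \<and>
      (x, y) = a *\<^sub>R (0, 0) + b *\<^sub>R (u, 0) + e *\<^sub>R (0, v)"
    using assms by (intro exI[of _ "1 - x/u - y/v"] exI[of _ "x/u"] exI[of _ "y/v"]) auto
  then show "(x, y) \<in> convex hull {(0, 0), (u, 0), (0, v)}"
    unfolding convex_hull_3 by blast
qed

text \<open>The normalised coordinates are \<open>X = (1 - s) / p\<close> and
  \<open>Y = s / q\<close>, so \<open>p * X + q * Y = 1\<close> holds for every \<open>s\<close>.
  Multiplying the equation by \<open>(p * q)^2\<close> clears the denominators.\<close>

lemma mem_ellipse0_hypotenuse_iff:
  fixes c d C u v s :: real
  assumes "c > 0" "d > 0" "u > 0" "v > 0"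
  defines "p \<equiv> c / u" and "q \<equiv> d / v" and "m \<equiv> 1 - ladder_J c d C"
  shows "((1 - s) * u, s * v) \<in> ellipse0 c d C \<longleftrightarrow>
    ((1 - p) * q * (1 - s) + (1 - q) * p * s)^2 = 4 * m * p * q * (1 - s) * s"
proof -
  have pq: "p > 0" "q > 0" using assms by (simp_all add: p_def q_def)
  have X: "(1 - s) * u / c = (1 - s) / p" "s * v / d = s / q"
    using assms by (simp_all add: p_def q_def)
  have lhs: "((1 - s)/p + s/q - 1)^2 * (p * q)^2 = ((1 - p) * q * (1 - s) + (1 - q) * p * s)^2"
  proof -
    have "((1 - s)/p + s/q - 1) * (p * q) = (1 - p) * q * (1 - s) + (1 - q) * p * s"
      using pq by (simp add: field_simps)
    then show ?thesis by (metis power_mult_distrib)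
  qed
  have rhs: "4 * m * ((1 - s)/p) * (s/q) * (p * q)^2 = 4 * m * p * q * (1 - s) * s"
    using pq by (simp add: power2_eq_square)
  have "(p * q)^2 \<noteq> 0" using pq by simp
  then show ?thesis
    unfolding mem_ellipse0_iff[OF assms(1,2)] X m_def[symmetric] lhs[symmetric] rhs[symmetric]
    using mult_right_cancel by blast
qed

text \<open>The product equation expresses tangency of the whole line. It also has solutions with
  \<open>u < c\<close> and \<open>v < d\<close>, where the line touches the ellipse from the side of
  the origin; the two inequalities exclude them.\<close>

lemma inscribed_in_triangle_iff:
  fixes c d C u v :: real
  assumes "c > 0" "d > 0" "\<bar>C\<bar> < c * d" "u > 0" "v > 0"
  shows "inscribed_in_triangle (ellipse0 c d C) (0, 0) (u, 0) (0, v) \<longleftrightarrow>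
         c < u \<and> d < v \<and> (1 - c/u) * (1 - d/v) = 1 - ladder_J c d C"
proof -
  define p q m where "p = c / u" and "q = d / v" and "m = 1 - ladder_J c d C"
  have pq: "p > 0" "q > 0" using assms by (simp_all add: p_def q_def)
  have m: "0 < m" "m < 1" using ladder_J_bounds[OF assms(1-3)] by (simp_all add: m_def)
  note line = mem_ellipse0_hypotenuse_iff[OF assms(1,2,4,5), of _ C, folded p_def q_def m_def]
  show ?thesis (is "?L \<longleftrightarrow> ?R")
  proof
    assume ?L
    then have sub: "ellipse0 c d C \<subseteq> convex hull {(0, 0), (u, 0), (0, v)}"
      and tan: "tangent_to_side (ellipse0 c d C) (u, 0) (0, v)"
      by (simp_all add: inscribed_in_triangle_def)
    have "(c, 0) \<in> convex hull {(0, 0), (u, 0), (0, v)}"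
         "(0, d) \<in> convex hull {(0, 0), (u, 0), (0, v)}"
      using sub ellipse0_tangency_points by blast+
    then have le: "c \<le> u" "d \<le> v"
      using assms by (simp_all add: mem_triangle_iff)
    obtain r where r: "((1 - r) * u, r * v) \<in> ellipse0 c d C"
      and runiq: "\<And>s. ((1 - s) * u, s * v) \<in> ellipse0 c d C \<Longrightarrow>
                    ((1 - s) * u, s * v) = ((1 - r) * u, r * v)"
      using tan unfolding tangent_to_side_def affine_hull_hypotenuse closed_segment_hypotenuse
      by blast
    define a b where "a = 1 - p" and "b = 1 - q"
    \<comment> \<open>Coefficients of the equation in \<open>line\<close>, expanded in powers of
      \<open>s\<close>.\<close>
    define A B D where "A = (a*q - b*p)^2 + 4*m*p*q"
      and "B = 2*a*b*p*q - 2*a^2*q^2 - 4*m*p*q" and "D = a^2*q^2"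
    have quad: "((1 - s) * u, s * v) \<in> ellipse0 c d C \<longleftrightarrow> A * s^2 + B * s + D = 0" for s
      unfolding line a_def[symmetric] b_def[symmetric] A_def B_def D_def
      by (auto simp: power2_eq_square algebra_simps)
    have "A > 0" unfolding A_def using pq m
      by (intro add_nonneg_pos) auto
    have "B^2 = 4 * A * D"
    proof (rule quadratic_unique_root_discrim)
      show "A \<noteq> 0" using \<open>A > 0\<close> by simp
      show "A * r^2 + B * r + D = 0" using r by (simp only: quad)
      show "s = r" if "A * s^2 + B * s + D = 0" for s
        using runiq[of s] that assms(5) by (simp add: quad)
    qed
    moreover have "B^2 - 4 * A * D = 16 * p^2 * q^2 * m * (m - a * b)"
      unfolding A_def B_def D_def by (simp add: power2_eq_square algebra_simps)
    ultimately have ab: "a * b = m" using pq m by simp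
    \<comment> \<open>Containment gave only weak inequalities; \<open>m > 0\<close> rules out
      equality.\<close>
    then have "a \<noteq> 0" "b \<noteq> 0" using m by auto
    then have "c \<noteq> u" "d \<noteq> v" using assms by (auto simp: a_def b_def p_def q_def)
    then show ?R using le ab by (simp add: a_def b_def p_def q_def m_def)
  next
    assume R: ?R
    define a b where "a = 1 - p" and "b = 1 - q"
    have ab: "a > 0" "b > 0" "m = a * b"
      using R assms by (simp_all add: a_def b_def p_def q_def m_def)
    have "ellipse0 c d C \<subseteq> convex hull {(0, 0), (u, 0), (0, v)}"
    proof (clarify)
      fix x y assume "(x, y) \<in> ellipse0 c d C"
      then have eq: "(x/c + y/d - 1)^2 = 4 * m * (x/c) * (y/d)"
        using assms by (simp add: mem_ellipse0_iff m_def)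
      then have "(y/d + x/c - 1)^2 = 4 * m * (y/d) * (x/c)"
        by (simp add: algebra_simps)
      with eq m have nn: "x/c \<ge> 0" "y/d \<ge> 0" by (blast intro: conic_nonneg)+
      have "(1 - a) * (x/c) + (1 - b) * (y/d) \<le> 1"
        using conic_below_tangent[OF nn ab(1,2)] eq ab(3) by simp
      then have "x/u + y/v \<le> 1"
        using assms by (simp add: a_def b_def p_def q_def)
      then show "(x, y) \<in> convex hull {(0, 0), (u, 0), (0, v)}"
        using nn assms by (simp add: mem_triangle_iff zero_le_divide_iff)
    qed
    moreover have "tangent_to_side (ellipse0 c d C) (0, 0) (u, 0)"
    proof -
      have "(c, 0) \<in> closed_segment (0, 0) (u, 0)"
        using R assms by (auto simp: closed_segment_def intro!: exI[of _ "c/u"])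
      moreover have "ellipse0 c d C \<inter> affine hull {(0, 0), (u, 0)} = {(c, 0)}"
      proof -
        have "affine hull {(0, 0), (u, 0)} = range (\<lambda>s. (s * u, 0))"
          by (auto simp: affine_hull_2_alt)
        \<comment> \<open>On the horizontal axis the equation collapses to
          \<open>(x/c - 1)^2 = 0\<close>.\<close>
        moreover have "(s * u, 0) = (c, 0)" if "(s * u, 0) \<in> ellipse0 c d C" for s
          using that assms by (simp add: mem_ellipse0_iff)
        moreover have "(c, 0) = (c/u * u, 0)" using assms by simp
        then have "(c, 0) \<in> range (\<lambda>s. (s * u, 0))" by (rule range_eqI)
        ultimately show ?thesis using ellipse0_tangency_points(1)[of c d C] by auto
      qed
      ultimately show ?thesis unfolding tangent_to_side_def by blast
    qed
    moreover have "tangent_to_side (ellipse0 c d C) (0, v) (0, 0)"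
    proof -
      \<comment> \<open>This side runs from \<open>(0, v)\<close> down to the origin, hence the
        parameter \<open>1 - d/v\<close>.\<close>
      have "(0, d) \<in> closed_segment (0, v) (0, 0)"
        using R assms by (auto simp: closed_segment_def intro!: exI[of _ "1 - d/v"])
      moreover have "ellipse0 c d C \<inter> affine hull {(0, v), (0, 0)} = {(0, d)}"
      proof -
        have "affine hull {(0, v), (0, 0)} = range (\<lambda>s. (0, (1 - s) * v))"
          by (auto simp: affine_hull_2_alt algebra_simps)
        moreover have "(0, (1 - s) * v) = (0, d)" if "(0, (1 - s) * v) \<in> ellipse0 c d C" for s
          using that assms by (simp add: mem_ellipse0_iff)
        moreover have "(0, d) = (0, (1 - (1 - d/v)) * v)" using assms by simp
        then have "(0, d) \<in> range (\<lambda>s. (0, (1 - s) * v))" by (rule range_eqI)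
        ultimately show ?thesis using ellipse0_tangency_points(2)[of d c C] by auto
      qed
      ultimately show ?thesis unfolding tangent_to_side_def by blast
    qed
    moreover have "tangent_to_side (ellipse0 c d C) (u, 0) (0, v)"
    proof -
      \<comment> \<open>For \<open>m = a * b\<close> the equation on the line is the square of
        \<open>a * q * (1 - s) - b * p * s\<close>, and \<open>r\<close> is its zero. It lies
        between 0 and 1 because \<open>a\<close> and \<open>b\<close> are positive.\<close>
      define r where "r = a * q / (a * q + b * p)"
      have pos: "a * q > 0" "b * p > 0" using pq ab by simp_all
      have r01: "r \<in> {0..1}" using pos by (simp add: r_def divide_simps)
      have "((1 - s) * u, s * v) \<in> ellipse0 c d C \<longleftrightarrow> s = r" for s
      proof -
        have "(a * q * (1 - s) + b * p * s)^2 - 4 * m * p * q * (1 - s) * s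
              = (a * q * (1 - s) - b * p * s)^2"
          unfolding ab(3) by (simp add: power2_eq_square algebra_simps)
        then have "((1 - s) * u, s * v) \<in> ellipse0 c d C \<longleftrightarrow> a * q * (1 - s) - b * p * s = 0"
          unfolding line a_def[symmetric] b_def[symmetric]
          by (metis eq_iff_diff_eq_0 zero_eq_power2)
        also have "\<dots> \<longleftrightarrow> s * (a * q + b * p) = a * q" by (auto simp: algebra_simps)
        also have "\<dots> \<longleftrightarrow> s = r" using pos by (simp add: r_def eq_divide_eq)
        finally show ?thesis .
      qed
      then show ?thesis
        unfolding tangent_to_side_def affine_hull_hypotenuse closed_segment_hypotenuse
        using r01 by (intro bexI[of _ "((1 - r) * u, r * v)"]) auto
    qed
    ultimately show ?L by (simp add: inscribed_in_triangle_def)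
  qed
qed

section \<open>The length function\<close>

text \<open>With \<open>t = c/u\<close> the tangency equation becomes
  \<open>(1 - t) * (d/v) = J - t\<close>. This determines \<open>v\<close> and forces
  \<open>t < J\<close>; conversely \<open>t < J < 1\<close> gives back \<open>c < u\<close> and
  \<open>d < v\<close>.\<close>

lemma admissible_ladders_eq_image:
  fixes c d C :: real
  assumes "c > 0" "d > 0" "\<bar>C\<bar> < c * d"
  defines "J \<equiv> ladder_J c d C"
  shows "admissible_ladders c d C s =
         (\<lambda>t. (c/t, d * (1 - t) / (J - t))) ` {t \<in> {0<..<J}. ladder_f c d C t = s^2}"
proof (intro set_eqI iffI; clarify)
  note J = ladder_J_bounds[OF assms(1-3), folded J_def]
  fix u v assume "(u, v) \<in> admissible_ladders c d C s"
  then have uv: "u > 0" "v > 0" "u^2 + v^2 = s^2" "c < u" "d < v"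
      "(1 - c/u) * (1 - d/v) = 1 - J"
    using inscribed_in_triangle_iff[OF assms(1-3)]
    by (auto simp: admissible_ladders_def J_def)
  define t where "t = c/u"
  have t: "t > 0" "t < 1" using uv assms by (simp_all add: t_def)
  have e: "(1 - t) * (d/v) = J - t" using uv(6) by (simp add: t_def algebra_simps)
  moreover have "(1 - t) * (d/v) > 0" using t uv assms by simp
  ultimately have tJ: "t < J" by simp
  have u: "u = c/t" using uv assms by (simp add: t_def)
  have v: "v = d * (1 - t) / (J - t)" using e tJ uv by (simp add: field_simps)
  have "ladder_f c d C t = s^2"
    using uv(3) u v by (simp add: ladder_f_def J_def power_divide power_mult_distrib)
  then show "(u, v) \<in> (\<lambda>t. (c/t, d * (1 - t) / (J - t))) ` {t \<in> {0<..<J}. ladder_f c d C t = s^2}"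
    using t tJ u v by auto
next
  note J = ladder_J_bounds[OF assms(1-3), folded J_def]
  fix t assume t: "t \<in> {0<..<J}" and f: "ladder_f c d C t = s^2"
  define u v where "u = c/t" and "v = d * (1 - t) / (J - t)"
  have p: "c/u = t" "d/v = (J - t) / (1 - t)" using t J assms by (simp_all add: u_def v_def)
  have pos: "u > 0" "v > 0" using t J assms by (simp_all add: u_def v_def)
  have "c < u" using t J assms by (simp add: u_def field_simps)
  moreover have "d < v" using t J assms by (simp add: v_def field_simps)
  moreover have "(1 - c/u) * (1 - d/v) = 1 - J" unfolding p using t J by (simp add: field_simps)
  moreover have "u^2 + v^2 = s^2"
    using f by (simp add: ladder_f_def J_def u_def v_def power_divide power_mult_distrib)
  ultimately have "(u, v) \<in> admissible_ladders c d C s"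
    using pos inscribed_in_triangle_iff[OF assms(1-3) pos]
    by (auto simp: admissible_ladders_def J_def)
  then show "(c/t, d * (1 - t) / (J - t)) \<in> admissible_ladders c d C s"
    by (simp add: u_def v_def)
qed

lemma card_admissible_ladders:
  assumes "c > 0" "d > 0" "\<bar>C\<bar> < c * d"
  shows "card (admissible_ladders c d C s) =
         card {t \<in> {0<..<ladder_J c d C}. ladder_f c d C t = s^2}"
  unfolding admissible_ladders_eq_image[OF assms]
  \<comment> \<open>The first intercept \<open>c/t\<close> already determines
    \<open>t\<close>.\<close>
  using assms by (intro card_image inj_onI) auto

section \<open>The derivative of the length function and its root\<close>

text \<open>The derivative of \<open>ladder_f\<close> for \<open>J = ladder_J c d C\<close>,
  factored so that the monotonicity of each piece is visible.\<close>

definition ladder_f' :: "real \<Rightarrow> real \<Rightarrow> real \<Rightarrow> real \<Rightarrow> real" where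
  "ladder_f' c d J t = 2 * (d^2 * (1 - J) * ((1 - t) / (J - t)) / (J - t)^2 - c^2 / t^3)"

lemma DERIV_ladder_f:
  assumes "0 < t" "t < ladder_J c d C"
  shows "(ladder_f c d C has_real_derivative ladder_f' c d (ladder_J c d C) t) (at t)"
proof -
  define J where "J = ladder_J c d C"
  have t: "t > 0" "J - t \<noteq> 0" using assms by (simp_all add: J_def)
  have 1: "((\<lambda>t. c / t) has_real_derivative - (c / t^2)) (at t)"
    using t by (auto intro!: derivative_eq_intros simp: power2_eq_square)
  have 2: "((\<lambda>t. d * ((1 - t) / (J - t))) has_real_derivative d * (1 - J) / (J - t)^2) (at t)"
    using t by (auto intro!: derivative_eq_intros simp: power2_eq_square field_simps)
  have "((\<lambda>t. (c / t)^2 + (d * ((1 - t) / (J - t)))^2) has_real_derivative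
        2 * (c/t) * - (c/t^2) + 2 * (d * ((1 - t) / (J - t))) * (d * (1 - J) / (J - t)^2)) (at t)"
    by (rule DERIV_cong[OF DERIV_add[OF DERIV_power[OF 1, of 2] DERIV_power[OF 2, of 2]]])
      (simp add: mult_ac)
  moreover have "ladder_f c d C = (\<lambda>t. (c / t)^2 + (d * ((1 - t) / (J - t)))^2)"
    by (simp add: fun_eq_iff ladder_f_def J_def power_divide power_mult_distrib)
  moreover have "2 * (c/t) * - (c/t^2) + 2 * (d * ((1 - t) / (J - t))) * (d * (1 - J) / (J - t)^2)
      = ladder_f' c d J t"
    by (simp add: ladder_f'_def power2_eq_square power3_eq_cube mult_ac)
  ultimately show ?thesis by (simp add: J_def)
qed

text \<open>The first summand is nondecreasing: \<open>(1 - t) / (J - t)\<close> grows, as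
  \<open>1 - J\<close> is positive, and \<open>(J - t)^2\<close> shrinks. Strictness comes from
  \<open>c^2 / t^3\<close>.\<close>

lemma ladder_f'_strict_mono:
  assumes "c > 0" "J < 1" "0 < s" "s < t" "t < J"
  shows "ladder_f' c d J s < ladder_f' c d J t"
proof -
  have "(1 - s) / (J - s) \<le> (1 - t) / (J - t)"
  proof -
    have "(1 - s) * (J - t) \<le> (1 - t) * (J - s)"
    proof -
      have "(1 - t) * (J - s) - (1 - s) * (J - t) = (1 - J) * (t - s)"
        by (simp add: algebra_simps)
      moreover have "\<dots> \<ge> 0" using assms by simp
      ultimately show ?thesis by linarith
    qed
    then show ?thesis using assms by (simp add: divide_le_eq pos_le_divide_eq mult.commute)
  qed
  moreover have "(J - t)^2 \<le> (J - s)^2" using assms by (intro power_mono) auto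
  moreover have "(1 - t) / (J - t) \<ge> 0" "(J - t)^2 > 0" using assms by simp_all
  ultimately have "d^2 * (1 - J) * ((1 - s) / (J - s)) / (J - s)^2
      \<le> d^2 * (1 - J) * ((1 - t) / (J - t)) / (J - t)^2"
    using assms by (meson frac_le mult_left_mono mult_nonneg_nonneg zero_le_power2 diff_ge_0_iff_ge less_imp_le)
  moreover have "c^2 / t^3 < c^2 / s^3"
    using assms by (intro divide_strict_left_mono power_strict_mono) auto
  ultimately show ?thesis by (simp add: ladder_f'_def)
qed

lemma ladder_f'_root:
  assumes "c > 0" "d > 0" "0 < J" "J < 1"
  obtains t0 where "0 < t0" "t0 < J" "ladder_f' c d J t0 = 0"
proof -
  \<comment> \<open>the numerator of the derivative, which unlike the derivative is defined at \<open>0\<close> and \<open>J\<close>\<close>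
  define P where "P t = d^2 * (1 - J) * (1 - t) * t^3 - c^2 * (J - t)^3" for t
  \<comment> \<open>The values are \<open>- c^2 * J^3\<close> at 0 and
    \<open>d^2 * (1 - J)^2 * J^3\<close> at \<open>J\<close>.\<close>
  have P0: "P 0 < 0" and PJ: "P J > 0" using assms by (simp_all add: P_def)
  have "continuous_on {0..J} P" unfolding P_def by (intro continuous_intros)
  then obtain t where t: "0 \<le> t" "t \<le> J" "P t = 0"
    using IVT'[of P 0 0 J] P0 PJ assms by auto
  then have "t \<noteq> 0" "t \<noteq> J" using P0 PJ by auto
  with t have tt: "0 < t" "t < J" by auto
  have "ladder_f' c d J t = 2 * P t / (t^3 * (J - t)^3)"
  proof -
    define e where "e = J - t"
    have "e \<noteq> 0" using tt by (simp add: e_def)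
    then show ?thesis using tt
      unfolding ladder_f'_def P_def e_def[symmetric]
      by (simp add: field_simps power2_eq_square power3_eq_cube)
  qed
  with t tt show thesis by (intro that) auto
qed

section \<open>Level sets of a function with a single minimum\<close>

text \<open>Each monotone branch takes a value at most once. Above the minimum the intermediate
  value theorem supplies one point per branch; \<open>left\<close> and \<open>right\<close> stand in
  for infinite limits at the two ends.\<close>

lemma unimodal_level_sets:
  fixes f :: "real \<Rightarrow> real"
  assumes t0: "a < t0" "t0 < b"
    and cont: "continuous_on {a<..<b} f"
    and anti: "strict_antimono_on {a<..t0} f"
    and mono: "strict_mono_on {t0..<b} f"
    and left: "\<And>y. \<exists>t. a < t \<and> t \<le> t0 \<and> y \<le> f t"
    and right: "\<And>y. \<exists>t. t0 \<le> t \<and> t < b \<and> y \<le> f t"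
  shows "y < f t0 \<Longrightarrow> {t \<in> {a<..<b}. f t = y} = {}"
    and "{t \<in> {a<..<b}. f t = f t0} = {t0}"
    and "y > f t0 \<Longrightarrow> card {t \<in> {a<..<b}. f t = y} = 2"
proof -
  have dec: "f t < f s" if "a < s" "s < t" "t \<le> t0" for s t
    using monotone_onD[OF anti] that by simp
  have inc: "f s < f t" if "t0 \<le> s" "s < t" "t < b" for s t
    using monotone_onD[OF mono] that by simp
  have min: "f t0 < f t" if "a < t" "t < b" "t \<noteq> t0" for t
    using that dec[of t t0] inc[of t0 t] by linarith
  then have "f t0 \<le> f t" if "a < t" "t < b" for t using that by fastforce
  then show "y < f t0 \<Longrightarrow> {t \<in> {a<..<b}. f t = y} = {}" by fastforce
  show "{t \<in> {a<..<b}. f t = f t0} = {t0}" using min t0 by fastforce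
  assume y: "y > f t0"
  obtain l where l: "a < l" "l \<le> t0" "y \<le> f l" using left by blast
  obtain r where r: "t0 \<le> r" "r < b" "y \<le> f r" using right by blast
  have "continuous_on {l..t0} f" "continuous_on {t0..r} f"
    using l r t0 by (auto intro: continuous_on_subset[OF cont])
  then obtain t1 t2 where t1: "l \<le> t1" "t1 \<le> t0" "f t1 = y" and t2: "t0 \<le> t2" "t2 \<le> r" "f t2 = y"
    using IVT2'[of f t0 y l] IVT'[of f t0 y r] l r y by (metis less_imp_le)
  have ne: "t1 < t0" "t0 < t2" using t1 t2 y by (auto simp: order_less_le)
  have "t = t1 \<or> t = t2" if "a < t" "t < b" "f t = y" for t
  proof (cases "t \<le> t0")
    case True
    then show ?thesis using dec[of t t1] dec[of t1 t] that t1 l by (metis linorder_cases order_less_irrefl less_le_trans)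
  next
    case False
    then show ?thesis using inc[of t t2] inc[of t2 t] that t2 r by force
  qed
  then have "{t \<in> {a<..<b}. f t = y} = {t1, t2}" using t1 t2 l r t0 by auto
  then show "card {t \<in> {a<..<b}. f t = y} = 2" using ne by simp
qed

text \<open>Choose \<open>K > 0\<close> with \<open>y \<le> K^2\<close> and make one of the two
  square summands at least \<open>K^2\<close>. The first is when \<open>t \<le> c / K\<close>; the
  second is when \<open>e = J - t\<close> is at most \<open>d * (1 - J) / K\<close>, since
  \<open>1 - t \<ge> 1 - J\<close>. The minima keep \<open>t\<close> on the required side of
  \<open>t0\<close>.\<close>

lemma ladder_f_unbounded:
  assumes "c > 0" "d > 0" "0 < t0" "t0 < ladder_J c d C" "ladder_J c d C < 1"
  shows "\<exists>t. 0 < t \<and> t \<le> t0 \<and> y \<le> ladder_f c d C t"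
    and "\<exists>t. t0 \<le> t \<and> t < ladder_J c d C \<and> y \<le> ladder_f c d C t"
proof -
  define J K where "J = ladder_J c d C" and "K = sqrt \<bar>y\<bar> + 1"
  have K: "K > 0" "y \<le> K^2"
    unfolding K_def by (smt (verit) real_sqrt_ge_zero abs_ge_zero)
      (simp add: power2_eq_square algebra_simps, smt (verit) real_sqrt_ge_zero)
  show "\<exists>t. 0 < t \<and> t \<le> t0 \<and> y \<le> ladder_f c d C t"
  proof (intro exI conjI)
    let ?t = "min t0 (c / K)"
    show "0 < ?t" "?t \<le> t0" using assms K by auto
    have "K \<le> c / ?t" using assms K \<open>0 < ?t\<close> by (simp add: pos_le_divide_eq min_def field_simps)
    then have "K^2 \<le> (c / ?t)^2" using K by (intro power_mono) auto
    also have "\<dots> \<le> ladder_f c d C ?t"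
      by (simp add: ladder_f_def power_divide)
    finally show "y \<le> ladder_f c d C ?t" using K by linarith
  qed
  show "\<exists>t. t0 \<le> t \<and> t < ladder_J c d C \<and> y \<le> ladder_f c d C t"
  proof (intro exI conjI)
    define e where "e = min (J - t0) (d * (1 - J) / K)"
    have e: "e > 0" "e \<le> J - t0" "e \<le> d * (1 - J) / K"
      using assms K by (auto simp: e_def J_def)
    show "t0 \<le> J - e" "J - e < ladder_J c d C" using e by (auto simp: J_def)
    have "K * e \<le> d * (1 - J)" using e K by (simp add: field_simps)
    also have "\<dots> \<le> d * (1 - (J - e))" using e assms by (intro mult_left_mono) auto
    finally have "K \<le> d * (1 - (J - e)) / e" using e by (simp add: pos_le_divide_eq)
    then have "K^2 \<le> (d * (1 - (J - e)) / e)^2" using K by (intro power_mono) auto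
    also have "\<dots> \<le> ladder_f c d C (J - e)"
      by (simp add: ladder_f_def J_def[symmetric] power_divide power_mult_distrib)
    finally show "y \<le> ladder_f c d C (J - e)" using K by linarith
  qed
qed

section \<open>The critical point, the threshold length and the number of ladders\<close>

theorem mainTheorem1:
  fixes c d C :: real
  assumes "c > 0" and "d > 0" and "\<bar>C\<bar> < c * d"
  shows "(\<exists>!t0. is_critical_point c d C t0) \<and>
         (\<exists>!s0. is_threshold c d C s0) \<and>
         (\<forall>t0 s0. is_critical_point c d C t0 \<longrightarrow> is_threshold c d C s0 \<longrightarrow>
            s0^2 = ladder_f c d C t0 \<and>
            card (admissible_ladders c d C s0) = 1 \<and>
            (\<forall>s>s0. card (admissible_ladders c d C s) = 2))"
proof -
  define J f f' where "J = ladder_J c d C" and "f = ladder_f c d C" and "f' = ladder_f' c d J"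
  have J: "0 < J" "J < 1" using ladder_J_bounds[OF assms] by (simp_all add: J_def)
  obtain t0 where t0: "0 < t0" "t0 < J" "f' t0 = 0"
    using ladder_f'_root[OF assms(1,2) J] unfolding f'_def by blast
  have deriv: "(f has_real_derivative f' t) (at t)" if "0 < t" "t < J" for t
    using DERIV_ladder_f that by (simp add: f_def f'_def J_def)
  have mono: "f' s < f' t" if "0 < s" "s < t" "t < J" for s t
    using ladder_f'_strict_mono[OF assms(1) J(2)] that by (simp add: f'_def)
  have crit: "is_critical_point c d C t \<longleftrightarrow> t = t0" for t
  proof -
    have "deriv f t = f' t" if "0 < t" "t < J" using deriv[OF that] by (rule DERIV_imp_deriv)
    then have "is_critical_point c d C t \<longleftrightarrow> 0 < t \<and> t < J \<and> f' t = 0"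
      by (auto simp: is_critical_point_def f_def J_def)
    then show ?thesis using mono[of t t0] mono[of t0 t] t0 by (metis linorder_cases order_less_irrefl)
  qed
  have cont: "continuous_on {0<..<J} f"
    using deriv DERIV_isCont by (intro continuous_at_imp_continuous_on) fastforce
  have dec: "f t < f s" if "0 < s" "s < t" "t \<le> t0" for s t
  \<comment> \<open>The derivative vanishes at \<open>t0\<close>, which may be the endpoint
    \<open>t\<close>, so its sign is used only on the open interval.\<close>
  proof (rule DERIV_neg_imp_decreasing_open[OF \<open>s < t\<close>])
    show "\<exists>y. (f has_real_derivative y) (at x) \<and> y < 0" if "s < x" "x < t" for x
      using deriv[of x] mono[of x t0] t0 that \<open>0 < s\<close> \<open>t \<le> t0\<close> by auto
    show "continuous_on {s..t} f"
      using that t0 by (intro continuous_on_subset[OF cont]) auto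
  qed
  have inc: "f s < f t" if "t0 \<le> s" "s < t" "t < J" for s t
  proof (rule DERIV_pos_imp_increasing_open[OF \<open>s < t\<close>])
    show "\<exists>y. (f has_real_derivative y) (at x) \<and> 0 < y" if "s < x" "x < t" for x
      using deriv[of x] mono[of t0 x] t0 that \<open>t0 \<le> s\<close> \<open>t < J\<close> by auto
    show "continuous_on {s..t} f"
      using that t0 by (intro continuous_on_subset[OF cont]) auto
  qed
  have "strict_antimono_on {0<..t0} f" "strict_mono_on {t0..<J} f"
    using dec inc by (auto intro!: monotone_onI)
  note levels = unimodal_level_sets[OF t0(1,2) cont this
      ladder_f_unbounded[OF assms(1,2) t0(1) t0(2)[unfolded J_def] J(2)[unfolded J_def],
        folded f_def J_def]]
  define s0 where "s0 = sqrt (f t0)"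
  have "0 < c^2 / t0^2" using assms t0 by simp
  then have "f t0 > 0" unfolding f_def ladder_f_def
    by (intro add_pos_nonneg) auto
  then have s0: "s0 > 0" "s0^2 = f t0" by (simp_all add: s0_def)
  have card: "card (admissible_ladders c d C s) = card {t \<in> {0<..<J}. f t = s^2}" for s
    by (simp only: card_admissible_ladders[OF assms] f_def J_def)
  have above: "card (admissible_ladders c d C s) = 2" if "s > s0" for s
  proof -
    have "s0^2 < s^2" using that s0(1) by (intro power_strict_mono) auto
    then show ?thesis unfolding card s0(2) by (rule levels(3))
  qed
  have at: "card (admissible_ladders c d C s0) = 1"
    unfolding card s0(2) levels(2) by simp
  have below: "admissible_ladders c d C s = {}" if "0 < s" "s < s0" for s
  proof -
    have "s^2 < s0^2" using that by (intro power_strict_mono) auto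
    then have "{t \<in> {0<..<J}. f t = s^2} = {}" unfolding s0(2) by (rule levels(1))
    then show ?thesis
      by (simp only: admissible_ladders_eq_image[OF assms] f_def J_def image_empty)
  qed
  \<comment> \<open>Cardinalities 2 and 1 are nonzero, so these sets are not empty.\<close>
  have nonempty: "admissible_ladders c d C s \<noteq> {} \<longleftrightarrow> s0 \<le> s" if "s > 0" for s
    using above[of s] at below[of s] that by (cases s s0 rule: linorder_cases) auto
  \<comment> \<open>Two thresholds each lie in the other's set of attained lengths, so each is at
    most the other.\<close>
  have thr: "is_threshold c d C s \<longleftrightarrow> s = s0" for s
    unfolding is_threshold_def using nonempty s0(1) by (metis order_antisym order_refl)
  show ?thesis
    using above at s0(2) by (simp add: crit thr f_def)
qed

end
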